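(* Let $\mathrm{Coup}(E)$ be a connected coupling graph on $[n]$, $n\ge3$, and $\Gamma=(Q,C)$ a quantum circuit with $n$ qubits and $m$ gates. For every $k\in[m]$, the number of orbits of $V^k$ under the action of $G_X$ is $$|V^k/G_X|=\frac{\sum_{\tau\in\mathbb{S}_n}|B_\tau|}{2^p\, f!\cdot|\mathrm{Aut}(\mathrm{Coup}(E))|}.$$
   Context: Notation: $[n]=\{1,\dots,n\}$; $\mathbb{S}_n$ is the symmetric group on $[n]$; products are compositions; $\tau^{-1}(S)=\{\tau^{-1}(s):s\in S\}$. Coupling graph: a simple undirected connected graph $\mathrm{Coup}(E)=([n],E)$. Qubits $Q=\{q_1,\dots,q_n\}$ are identified with $[n]$; a gate is a two-element subset of $Q$; a quantum circuit is $\Gamma=(Q,C)$ with $C=(g^1,\dots,g^m)$ a sequence of gates. Fixing pattern: the gate graph $(Q,U)$ has vertex set $Q$ and edge set $U=\{g:g\in C\}$. The fixing pattern $\mathcal{F}=\{S_1,\dots,S_l\}$ is the partition of $Q$ whose parts are: each singleton consisting of a qubit in a connected component of $(Q,U)$ of size at least 3; each pair of qubits forming a connected component of size 2; and the set of all isolated vertices of $(Q,U)$ (the free set, if nonempty). $p$ is the number of such pairs and $f$ is the size of the free set. $\mathbb{S}_n(\mathcal{F})=\{a\in\mathbb{S}_n:a(S_i)=S_i\ \forall i\in[l]\}$. For $\tau\in\mathbb{S}_n$, $B_\tau=\{b\in\mathrm{Aut}(\mathrm{Coup}(E)):b(\tau^{-1}(S_i))=\tau^{-1}(S_i)\ \forall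 i\in[l]\}$. $V^k=\{\tau^k:\tau\in\mathbb{S}_n\}$, $k\in[m]$, are disjoint copies of $\mathbb{S}_n$. $G_X$ is the group of permutations $\tau^k\mapsto(a\tau b^{-1})^k$ (for all $\tau\in\mathbb{S}_n$, $k\in[m]$) with $(a,b)\in\mathbb{S}_n(\mathcal{F})\times\mathrm{Aut}(\mathrm{Coup}(E))$ (additionally fixing two extra vertices $s$ and $t$). *)

theory Defs
  imports
    Complex_Main
    "HOL-Algebra.Sym_Groups"
    "HOL-Algebra.Group_Action"
    "Graph_Theory.Graph_Theory"
begin

text \<open>
  Undirected graphs are given by a vertex set and a set of two-element edges. They are turned into
  the symmetric digraphs of the Graph_Theory library in order to use its notion of connectedness;
  in a symmetric digraph the strongly connected components are the connected components.
\<close>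

definition two_subsets :: "nat \<Rightarrow> nat set set" where
  "two_subsets n = {g. g \<subseteq> {1..n} \<and> card g = 2}"

definition ugraph :: "nat \<Rightarrow> nat set set \<Rightarrow> nat pair_pre_digraph" where
  "ugraph n E = \<lparr> pverts = {1..n}, parcs = {(u, v). {u, v} \<in> E} \<rparr>"

definition components :: "nat \<Rightarrow> nat set set \<Rightarrow> nat set set" where
  "components n E = pre_digraph.sccs_verts (with_proj (ugraph n E))"

definition coupling_graph :: "nat \<Rightarrow> nat set set \<Rightarrow> bool" where
  "coupling_graph n E \<longleftrightarrow> E \<subseteq> two_subsets n \<and> connected (with_proj (ugraph n E))"

definition Aut :: "nat \<Rightarrow> nat set set \<Rightarrow> (nat \<Rightarrow> nat) set" where
  "Aut n E = {b \<in> carrier (sym_group n).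
     \<forall>u\<in>{1..n}. \<forall>v\<in>{1..n}. {b u, b v} \<in> E \<longleftrightarrow> {u, v} \<in> E}"

text \<open>A circuit on the qubits \<open>{1..n}\<close> is its list of gates; repeated gates are allowed.\<close>

definition circuit :: "nat \<Rightarrow> nat set list \<Rightarrow> bool" where
  "circuit n C \<longleftrightarrow> set C \<subseteq> two_subsets n"

definition gate_pairs :: "nat \<Rightarrow> nat set list \<Rightarrow> nat set set" where
  "gate_pairs n C = {K \<in> components n (set C). card K = 2}"

definition free_set :: "nat \<Rightarrow> nat set list \<Rightarrow> nat set" where
  "free_set n C = {q \<in> {1..n}. \<forall>g\<in>set C. q \<notin> g}"

definition fixing_pattern :: "nat \<Rightarrow> nat set list \<Rightarrow> nat set set" where
  "fixing_pattern n C =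
     {{q} | q. \<exists>K\<in>components n (set C). card K \<ge> 3 \<and> q \<in> K}
     \<union> gate_pairs n C
     \<union> (if free_set n C = {} then {} else {free_set n C})"

definition sym_fixing :: "nat \<Rightarrow> nat set set \<Rightarrow> (nat \<Rightarrow> nat) set" where
  "sym_fixing n F = {a \<in> carrier (sym_group n). \<forall>S\<in>F. a ` S = S}"

definition B :: "nat \<Rightarrow> nat set set \<Rightarrow> nat set set \<Rightarrow> (nat \<Rightarrow> nat) \<Rightarrow> (nat \<Rightarrow> nat) set" where
  "B n E F \<tau> =
     {b \<in> Aut n E. \<forall>S\<in>F. b ` (inv_into UNIV \<tau> ` S) = inv_into UNIV \<tau> ` S}"

text \<open>\<open>Copy k \<tau>\<close> is the vertex \<open>\<tau>\<^sup>k\<close>, the copy of the permutation \<open>\<tau>\<close> in the \<open>k\<close>-th layer.\<close>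

datatype vertex = Source | Target | Copy nat "nat \<Rightarrow> nat"

definition layer :: "nat \<Rightarrow> nat \<Rightarrow> vertex set" where
  "layer n k = Copy k ` carrier (sym_group n)"

definition vertices :: "nat \<Rightarrow> nat \<Rightarrow> vertex set" where
  "vertices n m = {Source, Target} \<union> (\<Union>k\<in>{1..m}. layer n k)"

fun act :: "(nat \<Rightarrow> nat) \<Rightarrow> (nat \<Rightarrow> nat) \<Rightarrow> vertex \<Rightarrow> vertex" where
  "act a b Source = Source"
| "act a b Target = Target"
| "act a b (Copy k \<tau>) = Copy k (a \<circ> \<tau> \<circ> inv_into UNIV b)"

text \<open>
  The group of induced permutations of the vertex set (not the product of the two groups): distinct
  pairs \<open>(a, b)\<close> may give the same element. As for every \<open>BijGroup\<close>, its elements are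
  functions restricted to the set they permute.
\<close>

definition GX :: "nat \<Rightarrow> nat set set \<Rightarrow> nat set list \<Rightarrow> (vertex \<Rightarrow> vertex) monoid" where
  "GX n E C = (BijGroup (vertices n (length C)))
     \<lparr> carrier := {restrict (act a b) (vertices n (length C)) | a b.
         a \<in> sym_fixing n (fixing_pattern n C) \<and> b \<in> Aut n E} \<rparr>"

end

theory Submission
  imports Defs
begin

text \<open>
  Let \<open>A\<close> be the group of permutations that preserve every part of the fixing pattern. The product
  \<open>A \<times> Aut\<close> acts on the permutations of \<open>{1..n}\<close> by \<open>\<tau> \<mapsto> a \<tau> b\<inverse>\<close>. Although a pair
  \<open>(a, b)\<close> need not be determined by the permutation of the vertices that it induces, the pairs
  and the induced permutations have the same orbits, so the orbits can be counted with the product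
  group (\<open>orbits_GX_layer\<close>).

  By the orbit-stabilizer theorem the stabilizers of the points of one orbit have
  \<open>|A| |Aut|\<close> elements altogether; hence the sum of the orders of all stabilizers is the
  number of orbits times \<open>|A| |Aut|\<close> (\<open>sum_card_stabilizers\<close>). A pair fixes \<open>\<tau>\<close> exactly if
  \<open>a = \<tau> b \<tau>\<inverse>\<close>, and this conjugate preserves a part \<open>S\<close> exactly if \<open>b\<close> preserves
  \<open>\<tau>\<inverse>(S)\<close>. So the stabilizer of \<open>\<tau>\<close> is in bijection with \<open>B\<^sub>\<tau>\<close>
  (\<open>card_stabilizer_Copy\<close>), and the numerator of the formula is the sum of the stabilizer orders.

  The denominator is \<open>|A| |Aut|\<close>. To choose an element of \<open>A\<close> is to choose a permutation of each
  part independently (\<open>card_permutes_fixing_parts\<close>): a singleton contributes the factor 1, a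
  pair the factor 2 and the free set the factor \<open>f!\<close>. For this the fixing pattern has to be a
  partition, which holds because the free set consists of the components with a single vertex
  (\<open>free_set_component_iff\<close>).
\<close>

section \<open>Counting orbits by stabilizers\<close>

text \<open>
  This is the Cauchy-Frobenius count before the two summations are exchanged: the sum runs over
  points rather than over group elements.
\<close>

lemma (in group_action) sum_card_stabilizers:
  assumes "finite (carrier G)" and "finite E"
  shows "(\<Sum>x\<in>E. card (stabilizer G \<phi> x)) = card (orbits G E \<phi>) * order G"
proof -
  have "(\<Sum>x\<in>E. card (stabilizer G \<phi> x)) = (\<Sum>orb\<in>orbits G E \<phi>. \<Sum>x\<in>orb. card (stabilizer G \<phi> x))"
    using partition.disjoint_sum[OF orbit_partition assms(2)] by (rule sym)
  also have "\<dots> = (\<Sum>orb\<in>orbits G E \<phi>. order G)"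
    using card_stablizer_sum[OF assms(1)] by (intro sum.cong) auto
  finally show ?thesis by simp
qed

section \<open>The two-sided action on a layer\<close>

text \<open>
  The inverse on the right-hand factor of \<open>a \<tau> b\<inverse>\<close> reverses the order of composition once
  more, which is what makes this a left action of the direct product.
\<close>

lemma act_comp:
  assumes "bij b" and "bij b'"
  shows "act (a \<circ> a') (b \<circ> b') v = act a b (act a' b' v)"
  using assms by (cases v) (simp_all add: o_inv_distrib comp_assoc)

lemma act_id: "act id id v = v"
  by (cases v) simp_all

lemma act_layer:
  assumes "a permutes {1..n}" and "b permutes {1..n}" and "v \<in> layer n k"
  shows "act a b v \<in> layer n k"
  using assms by (auto simp: layer_def sym_group_carrier intro!: imageI permutes_compose permutes_inv)

lemma restrict_act_Bij:
  assumes a: "a permutes {1..n}" and b: "b permutes {1..n}"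
  shows "restrict (act a b) (layer n k) \<in> Bij (layer n k)"
proof -
  have "act (inv' a) (inv' b) (act a b v) = v" "act a b (act (inv' a) (inv' b) v) = v" for v
    using act_comp[of "inv' b" b "inv' a" a v] act_comp[of b "inv' b" a "inv' a" v]
      permutes_inv_o[OF a] permutes_inv_o[OF b] permutes_bij[OF b] permutes_bij[OF permutes_inv[OF b]]
    by (simp_all add: act_id)
  then have "bij_betw (act a b) (layer n k) (layer n k)"
    using act_layer[OF a b] act_layer[OF permutes_inv[OF a] permutes_inv[OF b]]
    by (intro bij_betwI[where g = "act (inv' a) (inv' b)"]) auto
  then show ?thesis
    by (auto simp: Bij_def cong: bij_betw_cong)
qed

lemma layer_action:
  "group_action (sym_group n \<times>\<times> sym_group n) (layer n k) (\<lambda>(a, b). restrict (act a b) (layer n k))"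
proof -
  let ?\<phi> = "\<lambda>(a, b). restrict (act a b) (layer n k)"
  have "?\<phi> \<in> hom (sym_group n \<times>\<times> sym_group n) (BijGroup (layer n k))"
  proof (rule homI)
    fix x assume "x \<in> carrier (sym_group n \<times>\<times> sym_group n)"
    then show "?\<phi> x \<in> carrier (BijGroup (layer n k))"
      by (auto simp: BijGroup_def sym_group_carrier restrict_act_Bij)
  next
    fix x y
    assume x: "x \<in> carrier (sym_group n \<times>\<times> sym_group n)"
      and y: "y \<in> carrier (sym_group n \<times>\<times> sym_group n)"
    obtain a b a' b' where xy: "x = (a, b)" "y = (a', b')" by (cases x, cases y)
    have p: "a permutes {1..n}" "b permutes {1..n}" "a' permutes {1..n}" "b' permutes {1..n}"
      using x y xy by (auto simp: sym_group_carrier)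
    show "?\<phi> (x \<otimes>\<^bsub>sym_group n \<times>\<times> sym_group n\<^esub> y) = ?\<phi> x \<otimes>\<^bsub>BijGroup (layer n k)\<^esub> ?\<phi> y"
      using p by (auto simp: xy BijGroup_def sym_group_mult restrict_act_Bij compose_def
          fun_eq_iff act_comp permutes_bij act_layer)
  qed
  then show ?thesis
    unfolding group_action_def group_hom_def group_hom_axioms_def
    by (simp add: DirProd_group sym_group_is_group group_BijGroup)
qed

lemma sym_fixing_subgroup: "subgroup (sym_fixing n F) (sym_group n)"
proof (rule group.subgroupI[OF sym_group_is_group])
  show "sym_fixing n F \<subseteq> carrier (sym_group n)" by (auto simp: sym_fixing_def)
  show "sym_fixing n F \<noteq> {}"
    using permutes_id[of "{1..n}"] by (auto simp: sym_fixing_def sym_group_carrier intro!: exI[of _ id])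
next
  fix a assume a: "a \<in> sym_fixing n F"
  then have p: "a permutes {1..n}" by (simp add: sym_fixing_def sym_group_carrier)
  have "inv' a ` S = S" if "S \<in> F" for S
  proof -
    have "inv' a ` (a ` S) = S" using permutes_inv_o(2)[OF p] by (simp add: image_comp)
    then show ?thesis using a that by (simp add: sym_fixing_def)
  qed
  then show "inv\<^bsub>sym_group n\<^esub> a \<in> sym_fixing n F"
    using p permutes_inv[OF p] by (simp add: sym_fixing_def sym_group_carrier)
next
  fix a b assume ab: "a \<in> sym_fixing n F" "b \<in> sym_fixing n F"
  then have "(a \<circ> b) ` S = S" if "S \<in> F" for S
    using that by (simp add: sym_fixing_def image_comp[symmetric] del: comp_apply)
  then show "a \<otimes>\<^bsub>sym_group n\<^esub> b \<in> sym_fixing n F"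
    using ab by (simp add: sym_fixing_def sym_group_mult sym_group_carrier permutes_compose del: comp_apply)
qed

lemma Aut_subgroup: "subgroup (Aut n E) (sym_group n)"
proof (rule group.subgroupI[OF sym_group_is_group])
  show "Aut n E \<subseteq> carrier (sym_group n)" by (auto simp: Aut_def)
  show "Aut n E \<noteq> {}"
    using permutes_id[of "{1..n}"] by (auto simp: Aut_def sym_group_carrier intro!: exI[of _ id])
next
  fix a assume a: "a \<in> Aut n E"
  then have p: "a permutes {1..n}" by (simp add: Aut_def sym_group_carrier)
  have "{inv' a u, inv' a v} \<in> E \<longleftrightarrow> {u, v} \<in> E" if "u \<in> {1..n}" "v \<in> {1..n}" for u v
  proof -
    have "inv' a u \<in> {1..n}" "inv' a v \<in> {1..n}"
      using that permutes_in_image[OF permutes_inv[OF p]] by blast+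
    then have "{a (inv' a u), a (inv' a v)} \<in> E \<longleftrightarrow> {inv' a u, inv' a v} \<in> E"
      using a unfolding Aut_def by blast
    then show ?thesis by (simp add: permutes_inverses[OF p])
  qed
  then show "inv\<^bsub>sym_group n\<^esub> a \<in> Aut n E"
    using p permutes_inv[OF p] by (simp add: Aut_def sym_group_carrier)
next
  fix a b assume ab: "a \<in> Aut n E" "b \<in> Aut n E"
  then have p: "a permutes {1..n}" "b permutes {1..n}"
    by (simp_all add: Aut_def sym_group_carrier)
  have "{a (b u), a (b v)} \<in> E \<longleftrightarrow> {u, v} \<in> E" if "u \<in> {1..n}" "v \<in> {1..n}" for u v
  proof -
    have "b u \<in> {1..n}" "b v \<in> {1..n}" using that permutes_in_image[OF p(2)] by blast+
    then show ?thesis using ab that unfolding Aut_def by blast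
  qed
  then show "a \<otimes>\<^bsub>sym_group n\<^esub> b \<in> Aut n E"
    using p by (simp add: Aut_def sym_group_mult sym_group_carrier permutes_compose)
qed

lemma fixing_pairs_action:
  "group_action ((sym_group n \<times>\<times> sym_group n)\<lparr>carrier := sym_fixing n F \<times> Aut n E\<rparr>) (layer n k)
     (\<lambda>(a, b). restrict (act a b) (layer n k))"
  by (intro group_action.induced_action[OF layer_action] DirProd_subgroups
      sym_group_is_group sym_fixing_subgroup Aut_subgroup)

text \<open>
  A stabilizing pair is determined by its second component \<open>b\<close>, the first one being forced to be
  \<open>\<tau> b \<tau>\<inverse>\<close>; that this conjugate preserves the parts is the condition that defines
  \<open>B\<^sub>\<tau>\<close>.
\<close>

lemma card_stabilizer_Copy:
  assumes \<tau>: "\<tau> permutes {1..n}"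
  shows "card (stabilizer ((sym_group n \<times>\<times> sym_group n)\<lparr>carrier := sym_fixing n F \<times> Aut n E\<rparr>)
      (\<lambda>(a, b). restrict (act a b) (layer n k)) (Copy k \<tau>)) = card (B n E F \<tau>)"
    (is "card ?S = _")
proof -
  have eq: "a \<circ> \<tau> \<circ> inv' b = \<tau> \<longleftrightarrow> a = \<tau> \<circ> b \<circ> inv' \<tau>" if "b permutes {1..n}" for a b
  proof
    assume "a \<circ> \<tau> \<circ> inv' b = \<tau>"
    then have "a \<circ> \<tau> \<circ> (inv' b \<circ> b) \<circ> inv' \<tau> = \<tau> \<circ> b \<circ> inv' \<tau>" by (simp add: comp_assoc[symmetric])
    then show "a = \<tau> \<circ> b \<circ> inv' \<tau>"
      by (simp add: permutes_inv_o[OF that] comp_assoc permutes_inv_o[OF \<tau>])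
  next
    assume a: "a = \<tau> \<circ> b \<circ> inv' \<tau>"
    have "\<tau> \<circ> b \<circ> (inv' \<tau> \<circ> \<tau>) \<circ> inv' b = \<tau>"
      by (simp add: permutes_inv_o[OF that] comp_assoc permutes_inv_o[OF \<tau>])
    then show "a \<circ> \<tau> \<circ> inv' b = \<tau>" by (simp add: a comp_assoc)
  qed
  have fixes_iff: "(\<tau> \<circ> b \<circ> inv' \<tau>) ` S = S \<longleftrightarrow> b ` (inv' \<tau> ` S) = inv' \<tau> ` S" for b S
  proof -
    have "(\<tau> \<circ> b \<circ> inv' \<tau>) ` S = \<tau> ` (b ` (inv' \<tau> ` S))" by (simp add: image_comp comp_assoc)
    moreover have "S = \<tau> ` (inv' \<tau> ` S)" by (simp add: image_comp permutes_inv_o[OF \<tau>])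
    ultimately have "(\<tau> \<circ> b \<circ> inv' \<tau>) ` S = S \<longleftrightarrow> \<tau> ` (b ` (inv' \<tau> ` S)) = \<tau> ` (inv' \<tau> ` S)" by metis
    also have "\<dots> \<longleftrightarrow> b ` (inv' \<tau> ` S) = inv' \<tau> ` S"
      using permutes_inj[OF \<tau>] by (rule inj_image_eq_iff)
    finally show ?thesis .
  qed
  have "Copy k \<tau> \<in> layer n k" using \<tau> by (simp add: layer_def sym_group_carrier)
  then have "?S = {(a, b). a \<in> sym_fixing n F \<and> b \<in> Aut n E \<and> a \<circ> \<tau> \<circ> inv' b = \<tau>}"
    by (auto simp: stabilizer_def)
  also have "\<dots> = (\<lambda>b. (\<tau> \<circ> b \<circ> inv' \<tau>, b)) ` B n E F \<tau>"
  proof (intro equalityI subsetI)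
    fix x assume "x \<in> {(a, b). a \<in> sym_fixing n F \<and> b \<in> Aut n E \<and> a \<circ> \<tau> \<circ> inv' b = \<tau>}"
    then obtain a b where x: "x = (a, b)" "a \<in> sym_fixing n F" "b \<in> Aut n E" "a \<circ> \<tau> \<circ> inv' b = \<tau>"
      by auto
    then have "a = \<tau> \<circ> b \<circ> inv' \<tau>" using eq by (auto simp: Aut_def sym_group_carrier)
    then show "x \<in> (\<lambda>b. (\<tau> \<circ> b \<circ> inv' \<tau>, b)) ` B n E F \<tau>"
      using x fixes_iff by (auto simp: B_def sym_fixing_def)
  next
    fix x assume "x \<in> (\<lambda>b. (\<tau> \<circ> b \<circ> inv' \<tau>, b)) ` B n E F \<tau>"
    then obtain b where x: "x = (\<tau> \<circ> b \<circ> inv' \<tau>, b)" and b: "b \<in> B n E F \<tau>" by auto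
    then have bp: "b permutes {1..n}" by (auto simp: B_def Aut_def sym_group_carrier)
    have "\<tau> \<circ> b \<circ> inv' \<tau> \<in> sym_fixing n F"
      using b bp \<tau> fixes_iff
      by (auto simp only: B_def sym_fixing_def sym_group_carrier mem_Collect_eq
          intro!: permutes_compose permutes_inv)
    then show "x \<in> {(a, b). a \<in> sym_fixing n F \<and> b \<in> Aut n E \<and> a \<circ> \<tau> \<circ> inv' b = \<tau>}"
      using b eq[OF bp] x by (simp add: B_def)
  qed
  finally show ?thesis by (simp add: card_image inj_on_def)
qed

text \<open>
  An orbit depends only on the images of its base point, so nothing changes when pairs that induce
  the same permutation of the vertices are identified.
\<close>

lemma orbits_GX_layer:
  assumes "k \<in> {1..length C}"
  shows "orbits (GX n E C) (layer n k) (\<lambda>g. restrict g (layer n k)) =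
    orbits ((sym_group n \<times>\<times> sym_group n)\<lparr>carrier := sym_fixing n (fixing_pattern n C) \<times> Aut n E\<rparr>)
      (layer n k) (\<lambda>(a, b). restrict (act a b) (layer n k))"
proof -
  let ?A = "sym_fixing n (fixing_pattern n C)"
  \<comment> \<open>With orbits and the group written as images, both sides are images of the set of pairs.\<close>
  have orbit_image: "Group_Action.orbit G \<phi> v = (\<lambda>g. \<phi> g v) ` carrier G"
    for G :: "('c, 'd) monoid_scheme" and \<phi> :: "'c \<Rightarrow> vertex \<Rightarrow> vertex" and v
    by (auto simp: Group_Action.orbit_def)
  have carrier_GX: "carrier (GX n E C) =
      (\<lambda>(a, b). restrict (act a b) (vertices n (length C))) ` (?A \<times> Aut n E)"
    by (auto simp: GX_def)
  have "Group_Action.orbit (GX n E C) (\<lambda>g. restrict g (layer n k)) v =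
    Group_Action.orbit ((sym_group n \<times>\<times> sym_group n)\<lparr>carrier := ?A \<times> Aut n E\<rparr>)
      (\<lambda>(a, b). restrict (act a b) (layer n k)) v" if v: "v \<in> layer n k" for v
  proof -
    have "v \<in> vertices n (length C)" using v assms by (auto simp: vertices_def)
    then show ?thesis
      unfolding orbit_image carrier_GX image_image using v by (intro image_cong) auto
  qed
  then show ?thesis unfolding orbits_def by auto
qed

section \<open>Permutations that preserve every part of a partition\<close>

lemma perm_restrict_permutes:
  assumes "inj p" and "p ` S = S"
  shows "perm_restrict p S permutes S"
proof (rule bij_imp_permutes)
  have "bij_betw p S S" using assms by (auto simp: bij_betw_def inj_on_def)
  then show "bij_betw (perm_restrict p S) S S"
    by (rule iffD1[OF bij_betw_cong, rotated]) (simp add: perm_restrict_simps)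
qed (simp add: perm_restrict_simps)

lemma permutes_image_disjoint:
  assumes "p permutes S" and "S \<inter> T = {}"
  shows "p ` T = T"
proof -
  have "p x = x" if "x \<in> T" for x
    using that assms by (intro permutes_not_in[OF assms(1)]) blast
  then show ?thesis by simp
qed

text \<open>
  Splitting off one part \<open>S\<close>, such a permutation is uniquely the product of a permutation of \<open>S\<close>
  and one of the remaining parts: each factor acts as the identity where the other one moves points.
\<close>

lemma card_permutes_fixing_parts:
  assumes "finite P" and "\<And>S. S \<in> P \<Longrightarrow> finite S" and "pairwise disjnt P"
  shows "card {p. p permutes \<Union>P \<and> (\<forall>S\<in>P. p ` S = S)} = (\<Prod>S\<in>P. fact (card S))"
  using assms
proof (induction P rule: finite_induct)
  case empty
  then show ?case by simp
next
  case (insert S P)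
  let ?X = "\<lambda>P. {p. p permutes \<Union>P \<and> (\<forall>S\<in>P. p ` S = S)}"
  let ?join = "\<lambda>(p, q). p \<circ> q"
  let ?split = "\<lambda>r. (perm_restrict r S, perm_restrict r (\<Union>P))"
  have disj: "S \<inter> \<Union>P = {}"
    using insert.prems(2) insert.hyps(2) by (auto simp: pairwise_insert disjnt_def)
  have image_UnionP: "r ` \<Union>P = \<Union>P" if "r \<in> ?X (insert S P)" for r
  proof -
    have "r ` \<Union>P = (\<Union>T\<in>P. r ` T)" by auto
    also have "\<dots> = (\<Union>T\<in>P. T)" using that by (intro SUP_cong) auto
    finally show ?thesis by simp
  qed
  have bij: "bij_betw ?split (?X (insert S P)) ({p. p permutes S} \<times> ?X P)"
  proof (rule bij_betwI[where g = ?join])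
    show "?split \<in> ?X (insert S P) \<rightarrow> {p. p permutes S} \<times> ?X P"
    proof
      fix r assume r: "r \<in> ?X (insert S P)"
      have "perm_restrict r (\<Union>P) ` T = T" if "T \<in> P" for T
      proof -
        have "perm_restrict r (\<Union>P) ` T = r ` T"
          using that by (intro image_cong) (auto simp: perm_restrict_def)
        then show ?thesis using r that by simp
      qed
      then show "?split r \<in> {p. p permutes S} \<times> ?X P"
        using r image_UnionP[OF r] by (auto intro!: perm_restrict_permutes permutes_inj)
    qed
    show "?join \<in> {p. p permutes S} \<times> ?X P \<rightarrow> ?X (insert S P)"
    proof
      fix x assume "x \<in> {p. p permutes S} \<times> ?X P"
      then obtain p q where x: "x = (p, q)" and p: "p permutes S" and q: "q permutes \<Union>P"
        and qT: "\<forall>T\<in>P. q ` T = T" by auto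
      have "(p \<circ> q) ` T = T" if "T \<in> P" for T
      proof -
        have "p ` T = T" using disj that by (intro permutes_image_disjoint[OF p]) blast
        then show ?thesis using qT that by (metis image_comp)
      qed
      moreover have "(p \<circ> q) ` S = S"
      proof -
        have "q ` S = S" using disj by (intro permutes_image_disjoint[OF q]) blast
        then show ?thesis using permutes_image[OF p] by (metis image_comp)
      qed
      moreover have "p \<circ> q permutes \<Union>(insert S P)"
        by (intro permutes_compose permutes_subset[OF p] permutes_subset[OF q]) auto
      ultimately show "?join x \<in> ?X (insert S P)" by (simp add: x)
    qed
  next
    fix r assume r: "r \<in> ?X (insert S P)"
    then have "perm_restrict r S permutes S"
      by (auto intro!: perm_restrict_permutes permutes_inj)
    moreover have "perm_restrict r (\<Union>P) permutes \<Union>P"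
      using r image_UnionP[OF r] by (intro perm_restrict_permutes) (auto intro: permutes_inj)
    ultimately have "perm_restrict r S \<circ> perm_restrict r (\<Union>P) = perm_restrict r (\<Union>(insert S P))"
      using disj by (simp add: perm_restrict_union)
    then show "?join (?split r) = r" using r by simp
  next
    fix x assume "x \<in> {p. p permutes S} \<times> ?X P"
    then obtain p q where x: "x = (p, q)" and p: "p permutes S" and q: "q permutes \<Union>P" by auto
    have "perm_restrict (p \<circ> q) S = p"
    proof
      fix i
      have "q i = i" if "i \<in> S" using that disj permutes_not_in[OF q, of i] by blast
      then show "perm_restrict (p \<circ> q) S i = p i"
        using permutes_not_in[OF p, of i] by (simp add: perm_restrict_def)
    qed
    moreover have "perm_restrict (p \<circ> q) (\<Union>P) = q"
    proof
      fix i
      have "q i \<notin> S" if "i \<in> \<Union>P" using that permutes_in_image[OF q, of i] disj by blast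
      then show "perm_restrict (p \<circ> q) (\<Union>P) i = q i"
        using permutes_not_in[OF q, of i] permutes_not_in[OF p, of "q i"]
        by (auto simp: perm_restrict_def)
    qed
    ultimately show "?split (?join x) = x" by (simp add: x)
  qed
  have "card (?X (insert S P)) = card {p. p permutes S} * card (?X P)"
    using bij_betw_same_card[OF bij] by (simp add: card_cartesian_product)
  also have "\<dots> = fact (card S) * (\<Prod>S\<in>P. fact (card S))"
    using insert by (simp add: card_permutations pairwise_insert)
  finally show ?case using insert.hyps by simp
qed

section \<open>The fixing pattern as a partition\<close>

lemma wf_digraph_ugraph:
  assumes "U \<subseteq> two_subsets n"
  shows "wf_digraph (with_proj (ugraph n U))"
  unfolding wf_digraph_wp_iff
  using assms by unfold_locales (auto simp: ugraph_def two_subsets_def)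

lemma Union_components:
  assumes "U \<subseteq> two_subsets n"
  shows "\<Union>(components n U) = {1..n}"
proof -
  interpret wf_digraph "with_proj (ugraph n U)" using assms by (rule wf_digraph_ugraph)
  have "\<Union>(scc_of ` verts (with_proj (ugraph n U))) = verts (with_proj (ugraph n U))"
    using in_scc_of_self by (auto simp: scc_of_def dest: reachable_in_verts)
  then show ?thesis
    unfolding components_def sccs_verts_conv_scc_of by (simp add: ugraph_def)
qed

lemma components_disjoint:
  assumes "U \<subseteq> two_subsets n"
    and "K \<in> components n U" and "L \<in> components n U" and "q \<in> K" and "q \<in> L"
  shows "K = L"
  using assms(2-) wf_digraph.sccs_verts_disjoint[OF wf_digraph_ugraph[OF assms(1)]]
  unfolding components_def by blast

text \<open>
  Components are defined as strong components of a digraph; an edge gives arcs in both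
  directions, so that it cannot leave one.
\<close>

lemma edge_subset_component:
  assumes "U \<subseteq> two_subsets n" and "K \<in> components n U" and "{u, v} \<in> U" and "u \<in> K"
  shows "v \<in> K"
proof -
  interpret wf_digraph "with_proj (ugraph n U)" using assms(1) by (rule wf_digraph_ugraph)
  have "u \<rightarrow>\<^bsub>with_proj (ugraph n U)\<^esub> v" "v \<rightarrow>\<^bsub>with_proj (ugraph n U)\<^esub> u"
    using assms(3) by (auto simp: ugraph_def insert_commute arcs_ends_conv)
  then show ?thesis
    using assms(2,4) unfolding components_def in_sccs_verts_conv_reachable by blast
qed

lemma component_of_isolated:
  assumes "U \<subseteq> two_subsets n" and "K \<in> components n U" and "q \<in> K" and "\<forall>g\<in>U. q \<notin> g"
  shows "K = {q}"
proof -
  have "v = q" if "v \<in> K" for v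
  proof (rule ccontr)
    assume "v \<noteq> q"
    have "q \<rightarrow>\<^sup>*\<^bsub>with_proj (ugraph n U)\<^esub> v"
      using assms(2,3) that unfolding components_def pre_digraph.sccs_verts_def by blast
    then show False
    proof (rule pre_digraph.converse_reachable_cases)
      assume "q = v"
      then show False using \<open>v \<noteq> q\<close> by simp
    next
      fix w assume "q \<rightarrow>\<^bsub>with_proj (ugraph n U)\<^esub> w"
      then show False using assms(4) by (auto simp: ugraph_def arcs_ends_conv)
    qed
  qed
  then show ?thesis using assms(3) by blast
qed

text \<open>
  The free set is defined through the gates and the other parts of the fixing pattern through
  component sizes. This equivalence expresses the free set by component sizes too, so that the
  three kinds of parts belong to the sizes 1, 2 and at least 3.
\<close>

lemma free_set_component_iff:
  assumes "circuit n C" and "K \<in> components n (set C)" and "q \<in> K"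
  shows "q \<in> free_set n C \<longleftrightarrow> card K < 2"
proof -
  have U: "set C \<subseteq> two_subsets n" using assms(1) by (simp add: circuit_def)
  have K: "K \<subseteq> {1..n}" using Union_components[OF U] assms(2) by blast
  then have fin: "finite K" by (rule finite_subset) simp
  show ?thesis
  proof
    assume "q \<in> free_set n C"
    then show "card K < 2"
      using component_of_isolated[OF U assms(2,3)] by (simp add: free_set_def)
  next
    assume card: "card K < 2"
    show "q \<in> free_set n C"
    proof (rule ccontr)
      assume "q \<notin> free_set n C"
      then obtain g where g: "g \<in> set C" "q \<in> g" using assms(3) K by (auto simp: free_set_def)
      then obtain v where v: "g = {q, v}" "q \<noteq> v"
        using U by (auto simp: two_subsets_def card_2_iff)
      then have "v \<in> K" using edge_subset_component[OF U assms(2)] g assms(3) by blast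
      then have "card {q, v} \<le> card K" using assms(3) fin by (intro card_mono) auto
      then show False using card v by simp
    qed
  qed
qed

text \<open>
  As the parts form a set of sets, the product over all parts factors into the three kinds only
  if no part is of two kinds. Cardinality does not separate them, since the free set may have one
  or two elements; they are kept apart by being disjoint and nonempty.
\<close>

lemma card_sym_fixing:
  assumes C: "circuit n C"
  shows "card (sym_fixing n (fixing_pattern n C))
    = 2 ^ card (gate_pairs n C) * fact (card (free_set n C))"
proof -
  have U: "set C \<subseteq> two_subsets n" using C by (simp add: circuit_def)
  define L where "L = {{q} | q. \<exists>K\<in>components n (set C). card K \<ge> 3 \<and> q \<in> K}"
  define Z where "Z = (if free_set n C = {} then {} else {free_set n C})"
  have F: "fixing_pattern n C = L \<union> gate_pairs n C \<union> Z"
    by (simp add: fixing_pattern_def L_def Z_def)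
  note free = free_set_component_iff[OF C]
  have LP: "disjnt S T" if "S \<in> L" "T \<in> gate_pairs n C" for S T
    using that components_disjoint[OF U] by (fastforce simp: L_def gate_pairs_def disjnt_def)
  have LZ: "disjnt S T" if "S \<in> L" "T \<in> Z" for S T
    using that free by (fastforce simp: L_def Z_def disjnt_def split: if_splits)
  have PZ: "disjnt S T" if "S \<in> gate_pairs n C" "T \<in> Z" for S T
    using that free by (fastforce simp: gate_pairs_def Z_def disjnt_def split: if_splits)
  have PP: "disjnt S T" if "S \<in> gate_pairs n C" "T \<in> gate_pairs n C" "S \<noteq> T" for S T
    using that components_disjoint[OF U] by (fastforce simp: gate_pairs_def disjnt_def)
  have disj: "pairwise disjnt (fixing_pattern n C)"
  proof (rule pairwiseI)
    fix S T assume ST: "S \<in> fixing_pattern n C" "T \<in> fixing_pattern n C" "S \<noteq> T"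
    moreover have "disjnt S T" if "S \<in> L" "T \<in> L" using that ST(3) by (auto simp: L_def)
    moreover have "\<not> (S \<in> Z \<and> T \<in> Z)" using ST(3) by (auto simp: Z_def split: if_splits)
    ultimately show "disjnt S T"
      unfolding F using LP LZ PZ PP disjnt_sym by (metis UnE)
  qed
  have sub: "S \<subseteq> {1..n}" if "S \<in> fixing_pattern n C" for S
    using that Union_components[OF U]
    by (auto simp: F L_def gate_pairs_def Z_def free_set_def split: if_splits)
  have cover: "\<Union>(fixing_pattern n C) = {1..n}"
  proof
    show "\<Union>(fixing_pattern n C) \<subseteq> {1..n}" using sub by blast
    show "{1..n} \<subseteq> \<Union>(fixing_pattern n C)"
    proof
      fix q assume "q \<in> {1..n}"
      then obtain K where K: "K \<in> components n (set C)" "q \<in> K" using Union_components[OF U] by blast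
      consider "card K < 2" | "card K = 2" | "card K \<ge> 3" by linarith
      then show "q \<in> \<Union>(fixing_pattern n C)"
      proof cases
        case 1
        then show ?thesis using free[OF K] by (auto simp: F Z_def)
      next
        case 2
        then show ?thesis using K by (auto simp: F gate_pairs_def)
      next
        case 3
        then have "{q} \<in> L" using K by (auto simp: L_def)
        then show ?thesis by (auto simp: F)
      qed
    qed
  qed
  have fin: "finite (fixing_pattern n C)"
    using cover finite_UnionD by (metis finite_atLeastAtMost)
  then have fins: "finite L" "finite (gate_pairs n C)" "finite Z" by (simp_all add: F)
  have nonempty: "{} \<notin> L" "{} \<notin> gate_pairs n C"
    by (auto simp: L_def gate_pairs_def)
  have "sym_fixing n (fixing_pattern n C)
    = {p. p permutes \<Union>(fixing_pattern n C) \<and> (\<forall>S\<in>fixing_pattern n C. p ` S = S)}"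
    by (simp add: sym_fixing_def sym_group_carrier cover)
  moreover have "finite S" if "S \<in> fixing_pattern n C" for S
    using sub[OF that] by (rule finite_subset) simp
  ultimately have "card (sym_fixing n (fixing_pattern n C)) = (\<Prod>S\<in>fixing_pattern n C. fact (card S))"
    using card_permutes_fixing_parts[OF fin _ disj] by simp
  also have "\<dots> = (\<Prod>S\<in>L. fact (card S)) * (\<Prod>S\<in>gate_pairs n C. fact (card S)) * (\<Prod>S\<in>Z. fact (card S))"
  proof -
    have "L \<inter> gate_pairs n C = {}"
    proof (rule ccontr)
      assume "L \<inter> gate_pairs n C \<noteq> {}"
      then obtain S where "S \<in> L" "S \<in> gate_pairs n C" by blast
      then show False using LP[of S S] nonempty by simp
    qed
    moreover have "(L \<union> gate_pairs n C) \<inter> Z = {}"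
    proof (rule ccontr)
      assume "(L \<union> gate_pairs n C) \<inter> Z \<noteq> {}"
      then obtain S where "S \<in> L \<or> S \<in> gate_pairs n C" "S \<in> Z" by blast
      then show False using LZ[of S S] PZ[of S S] nonempty by auto
    qed
    ultimately show ?thesis using fins by (simp add: F prod.union_disjoint)
  qed
  also have "(\<Prod>S\<in>L. fact (card S)) = (1::nat)"
    by (rule prod.neutral) (auto simp: L_def)
  also have "(\<Prod>S\<in>gate_pairs n C. fact (card S)) = (\<Prod>S\<in>gate_pairs n C. (2::nat))"
    by (rule prod.cong) (auto simp: gate_pairs_def)
  also have "(\<Prod>S\<in>Z. fact (card S)) = (fact (card (free_set n C)) :: nat)"
    by (simp add: Z_def)
  finally show ?thesis by simp
qed

section \<open>The number of orbits of a layer\<close>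

theorem theorem3p8:
  fixes n m k :: nat and E :: "nat set set" and C :: "nat set list"
  assumes "n \<ge> 3"
    and "coupling_graph n E"
    and "circuit n C" and "length C = m"
    and "k \<in> {1..m}"
  shows "real (card (orbits (GX n E C) (layer n k) (\<lambda>g. restrict g (layer n k)))) =
    (\<Sum>\<tau>\<in>carrier (sym_group n). real (card (B n E (fixing_pattern n C) \<tau>))) /
    (2 ^ card (gate_pairs n C) * fact (card (free_set n C)) * real (card (Aut n E)))"
proof -
  let ?F = "fixing_pattern n C"
  let ?H = "(sym_group n \<times>\<times> sym_group n)\<lparr>carrier := sym_fixing n ?F \<times> Aut n E\<rparr>"
  let ?\<phi> = "\<lambda>(a, b). restrict (act a b) (layer n k)"
  have finS: "finite (carrier (sym_group n))"
    by (simp add: sym_group_def finite_permutations)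
  have finA: "finite (sym_fixing n ?F)" "finite (Aut n E)"
    using finS by (auto simp: sym_fixing_def Aut_def)
  have finH: "finite (carrier ?H)" and finL: "finite (layer n k)"
    using finA finS by (simp_all add: layer_def)
  have "(\<Sum>\<tau>\<in>carrier (sym_group n). card (B n E ?F \<tau>))
    = (\<Sum>\<tau>\<in>carrier (sym_group n). card (stabilizer ?H ?\<phi> (Copy k \<tau>)))"
    by (intro sum.cong) (simp_all add: card_stabilizer_Copy sym_group_carrier)
  also have "\<dots> = (\<Sum>v\<in>layer n k. card (stabilizer ?H ?\<phi> v))"
    unfolding layer_def by (simp add: sum.reindex inj_on_def)
  also have "\<dots> = card (orbits ?H (layer n k) ?\<phi>) * order ?H"
    using group_action.sum_card_stabilizers[OF fixing_pairs_action finH finL] .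
  also have "order ?H = card (sym_fixing n ?F) * card (Aut n E)"
    by (simp add: order_def card_cartesian_product)
  also have "card (orbits ?H (layer n k) ?\<phi>)
    = card (orbits (GX n E C) (layer n k) (\<lambda>g. restrict g (layer n k)))"
    using orbits_GX_layer assms(4,5) by simp
  finally have main: "(\<Sum>\<tau>\<in>carrier (sym_group n). card (B n E ?F \<tau>))
    = card (orbits (GX n E C) (layer n k) (\<lambda>g. restrict g (layer n k))) *
      (2 ^ card (gate_pairs n C) * fact (card (free_set n C)) * card (Aut n E))"
    by (simp add: card_sym_fixing[OF assms(3)])
  have "card (Aut n E) > 0"
    using finA(2) subgroup.one_closed[OF Aut_subgroup] by (auto simp: card_gt_0_iff)
  moreover have "(\<Sum>\<tau>\<in>carrier (sym_group n). real (card (B n E ?F \<tau>)))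
    = real (card (orbits (GX n E C) (layer n k) (\<lambda>g. restrict g (layer n k)))) *
      (2 ^ card (gate_pairs n C) * fact (card (free_set n C)) * real (card (Aut n E)))"
    using arg_cong[OF main, of real] by simp
  ultimately show ?thesis by (simp add: field_simps)
qed

end
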